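(* Let $a>1$ and $n\ge 1$ be integers. If $a^{2n}+a^n+1$ is prime, then $n=3^{j}$ for some integer $j\ge 0$. *)

theory Defs
  imports Main "HOL-Computational_Algebra.Primes"
begin

end

theory Submission
  imports Defs
begin

text \<open>
  Since $x^2 + x + 1$ divides $x^3 - 1$, its divisibility into $x^{2m} + x^m + 1$ depends only on
  $m$ modulo $3$, and it holds for $m \equiv 1, 2$. Write $n = 3^j m$ with $3 \nmid m$ and put
  $x = a^{3^j}$. Then $x^2 + x + 1 > 1$ divides the given prime, so the two are equal, which
  forces $m = 1$.
\<close>

text \<open>Modulo \<open>x\<^sup>2 + x + 1\<close> one has \<open>x ^ 3 = 1\<close>, so
  \<open>x ^ m\<close> reduces to \<open>x\<close> or \<open>x\<^sup>2\<close>. Squaring swaps these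
  two residues, so the sum reduces to 0 in either case.\<close>

lemma cyclotomic3_dvd_power:
  fixes x :: "'a::comm_ring_1"
  assumes "\<not> 3 dvd m"
  shows "x\<^sup>2 + x + 1 dvd x ^ (2 * m) + x ^ m + 1"
proof -
  define k where "k = m div 3"
  define c where "c = x ^ (3 * k)"
  let ?d = "x\<^sup>2 + x + 1"
  have "x ^ 3 - 1 = ?d * (x - 1)"
    by (simp add: algebra_simps power2_eq_square power3_eq_cube)
  hence "?d dvd x ^ 3 - 1" by (rule dvdI)
  also have "x ^ 3 - 1 dvd c - 1"
    using power_diff_1_eq[of "x ^ 3" k] by (simp add: c_def power_mult)
  finally obtain q where q: "c = ?d * q + 1"
    by (metis dvdE diff_add_cancel)
  have "m = 3 * k + 1 \<or> m = 3 * k + 2"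
    using assms unfolding k_def by presburger
  then show ?thesis
  proof
    assume m: "m = 3 * k + 1"
    have "x ^ m = c * x" by (simp add: m c_def)
    hence "x ^ (2 * m) + x ^ m + 1 = (c * x)\<^sup>2 + c * x + 1"
      by (simp add: power_mult[symmetric] mult.commute[of 2 m] power_mult)
    \<comment> \<open>Subtracting \<open>?d\<close> leaves
      \<open>(c\<^sup>2 - 1) * x\<^sup>2 + (c - 1) * x\<close>, where \<open>c - 1 = ?d * q\<close>
      and \<open>c\<^sup>2 - 1 = ?d * q * (c + 1)\<close>.\<close>
    also have "\<dots> = ?d * (1 + q * (c + 1) * x\<^sup>2 + q * x)"
      unfolding q by (simp add: algebra_simps power2_eq_square)
    finally show ?thesis by (rule dvdI)
  next
    assume m: "m = 3 * k + 2"
    have "x ^ m = c * x\<^sup>2" by (simp add: m c_def power_add power2_eq_square)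
    hence "x ^ (2 * m) + x ^ m + 1 = (c * x\<^sup>2)\<^sup>2 + c * x\<^sup>2 + 1"
      by (simp add: power_mult[symmetric] mult.commute[of 2 m] power_mult)
    \<comment> \<open>The same splitting, now around \<open>x ^ 4 + x\<^sup>2 + 1\<close>, which
      factors as \<open>?d * (x\<^sup>2 - x + 1)\<close>.\<close>
    also have "\<dots> = ?d * ((x\<^sup>2 - x + 1) + q * (c + 1) * x ^ 4 + q * x\<^sup>2)"
      unfolding q by (simp add: algebra_simps power2_eq_square power4_eq_xxxx)
    finally show ?thesis by (rule dvdI)
  qed
qed

theorem theorem1:
  fixes a :: int and n :: nat
  assumes "a > 1" and "n \<ge> 1"
    and "prime (a ^ (2 * n) + a ^ n + 1)"
  shows "\<exists>j::nat. n = 3 ^ j"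
proof -
  have "n \<noteq> 0" "\<not> is_unit (3::nat)" using assms(2) by auto
  then obtain m where n: "n = 3 ^ multiplicity 3 n * m" and m: "\<not> 3 dvd m"
    using multiplicity_decompose' by metis
  define j where "j = multiplicity 3 n"
  define x where "x = a ^ 3 ^ j"
  have x: "x > 1" unfolding x_def using assms(1) by (simp add: one_less_power)
  have an: "a ^ n = x ^ m" "a ^ (2 * n) = x ^ (2 * m)"
    using n by (metis j_def x_def power_mult, metis j_def x_def power_mult mult.left_commute)
  have "x\<^sup>2 + x + 1 dvd a ^ (2 * n) + a ^ n + 1"
    unfolding an using m by (rule cyclotomic3_dvd_power)
  moreover have "x\<^sup>2 + x + 1 > 1" using x by (simp add: add_pos_pos)
  ultimately have eq: "x\<^sup>2 + x + 1 = x ^ (2 * m) + x ^ m + 1"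
    using assms(3) unfolding an prime_int_iff by (smt (verit))
  have "m = 1"
  proof (rule ccontr)
    assume "m \<noteq> 1"
    moreover have "m \<noteq> 0" using m by (metis dvd_0_right)
    ultimately have "1 < m" by simp
    \<comment> \<open>Term by term, the right side of \<open>eq\<close> would exceed the
      left.\<close>
    hence "x ^ 1 < x ^ m" "x ^ 2 < x ^ (2 * m)"
      using x by (intro power_strict_increasing; simp)+
    with eq show False by simp
  qed
  with n show ?thesis by auto
qed

end
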